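(* If $n\in\mathbb{N}^+$ and $X$ is a separable metric space with $\dim_T X\geq n$, then \[d^n_T(X)=\dim_T X-n.\]
   Context: $\dim_T$ is the topological dimension (small inductive dimension: $\dim_T\emptyset=-1$ and $\dim_T X=\inf\{d: X$ has a basis $\mathcal{U}$ with $\dim_T\partial U\leq d-1$ for all $U\in\mathcal{U}\}$); it may be $\infty$, and $\infty-n=\infty$. For a separable metric space $X$ and $n\in\mathbb{N}^+$, $d^n_T(X)=\inf\{\dim_T(X\setminus F): F\subset X$ is an $F_\sigma$ set with $\dim_T F\leq n-1\}$. *)

theory Defs
  imports "HOL-Analysis.Analysis"
begin

text \<open>
  The library relation \<open>X dim_le d\<close> (\<open>d :: int\<close>, possible only for \<open>d \<ge> -1\<close>) says that
  the small inductive dimension of \<open>X\<close> is at most \<open>d\<close>. The dimension itself is an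
  extended real; \<open>Inf {} = \<infinity>\<close> covers the infinite-dimensional case. The lemmas
  \<open>dimT_empty\<close> and \<open>dimT_nonempty\<close> below recover the usual recursive definition by bases.
\<close>

definition dimT :: "'a topology \<Rightarrow> ereal" where
  "dimT X = Inf {ereal (of_int d) | d::int. X dim_le d}"

lemma dimT_le_iff: "dimT X \<le> ereal (of_int d) \<longleftrightarrow> X dim_le d"
proof
  assume "X dim_le d"
  then show "dimT X \<le> ereal (of_int d)"
    unfolding dimT_def by (auto intro: Inf_lower)
next
  assume le: "dimT X \<le> ereal (of_int d)"
  show "X dim_le d"
  proof (rule ccontr)
    assume not_le: "\<not> X dim_le d"
    have "ereal (of_int (d + 1)) \<le> dimT X"
      unfolding dimT_def
    proof (rule Inf_greatest)
      fix x assume "x \<in> {ereal (of_int e) | e::int. X dim_le e}"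
      then obtain e where e: "x = ereal (of_int e)" "X dim_le e" by blast
      then have "d + 1 \<le> e"
        using not_le dimension_le_mono[of X e d] by linarith
      then show "ereal (of_int (d + 1)) \<le> x"
        using e(1) by simp
    qed
    then have "ereal (of_int (d + 1)) \<le> ereal (of_int d)"
      using le by (rule order_trans)
    then show False by simp
  qed
qed

lemma dimT_ge: "-1 \<le> dimT X"
  unfolding dimT_def
proof (rule Inf_greatest)
  fix x assume "x \<in> {ereal (of_int e) | e::int. X dim_le e}"
  then obtain e where e: "x = ereal (of_int e)" "X dim_le e" by blast
  then have "(-1::real) \<le> of_int e"
    using dimension_le_bound[of X e] by linarith
  then show "-1 \<le> x"
    using e(1) by (simp add: one_ereal_def)
qed

lemma dimT_empty: "dimT (trivial_topology :: 'a topology) = -1"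
proof (rule antisym)
  have "dimT (trivial_topology :: 'a topology) \<le> ereal (of_int (-1))"
    by (subst dimT_le_iff) simp
  then show "dimT (trivial_topology :: 'a topology) \<le> -1"
    by (simp add: one_ereal_def)
qed (rule dimT_ge)

definition is_base :: "'a topology \<Rightarrow> 'a set set \<Rightarrow> bool" where
  "is_base X \<U> \<longleftrightarrow> openin X = arbitrary union_of (\<lambda>U. U \<in> \<U>)"

lemma dimT_nonempty:
  assumes "topspace X \<noteq> {}"
  shows "dimT X = Inf {ereal (of_int d) | d::int. \<exists>\<U>. is_base X \<U> \<and>
           (\<forall>U\<in>\<U>. dimT (subtopology X (X frontier_of U)) \<le> ereal (of_int d) - 1)}"
proof -
  have bd: "dimT Y \<le> ereal (of_int d) - 1 \<longleftrightarrow> Y dim_le (d - 1)" for Y :: "'a topology" and d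
    using dimT_le_iff[of Y "d - 1"] by (simp add: one_ereal_def)
  have "X dim_le d \<longleftrightarrow> (\<exists>\<U>. is_base X \<U> \<and>
          (\<forall>U\<in>\<U>. subtopology X (X frontier_of U) dim_le (d - 1)))" (is "_ \<longleftrightarrow> ?R") for d
  proof
    assume d: "X dim_le d"
    define \<U> where "\<U> = {U. openin X U \<and> subtopology X (X frontier_of U) dim_le (d - 1)}"
    have "is_base X \<U>"
      unfolding is_base_def openin_topology_base_unique
    proof (intro conjI allI impI)
      show "openin X V" if "V \<in> \<U>" for V
        using that by (simp add: \<U>_def)
      show "\<exists>U. U \<in> \<U> \<and> a \<in> U \<and> U \<subseteq> V" if V: "openin X V \<and> a \<in> V" for V a
      proof -
        have "\<exists>U. a \<in> U \<and> U \<subseteq> V \<and> openin X U \<and> subtopology X (X frontier_of U) dim_le (d - 1)"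
          using d V by (blast elim: dimension_le.cases)
        then show ?thesis
          unfolding \<U>_def by blast
      qed
    qed
    moreover have "\<forall>U\<in>\<U>. subtopology X (X frontier_of U) dim_le (d - 1)"
      by (simp add: \<U>_def)
    ultimately show ?R by blast
  next
    assume ?R
    then obtain \<U> where base: "is_base X \<U>"
      and \<U>: "\<And>U. U \<in> \<U> \<Longrightarrow> subtopology X (X frontier_of U) dim_le (d - 1)" by blast
    have op: "\<And>U. U \<in> \<U> \<Longrightarrow> openin X U"
      and nb: "\<And>V a. openin X V \<Longrightarrow> a \<in> V \<Longrightarrow> \<exists>U\<in>\<U>. a \<in> U \<and> U \<subseteq> V"
      using base unfolding is_base_def openin_topology_base_unique by blast+
    obtain a where "a \<in> topspace X" using assms by blast
    then obtain U where "U \<in> \<U>" using nb[of "topspace X" a] by auto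
    then have "-1 \<le> d"
      using dimension_le_bound[OF \<U>[of U]] by linarith
    then show "X dim_le d"
    proof (rule dimension_le.intros)
      fix V a assume "openin X V" "a \<in> V"
      then obtain U where "U \<in> \<U>" "a \<in> U" "U \<subseteq> V" using nb by blast
      then show "\<exists>U. a \<in> U \<and> U \<subseteq> V \<and> openin X U \<and> subtopology X (X frontier_of U) dim_le (d - 1)"
        using op \<U> by blast
    qed
  qed
  then show ?thesis
    unfolding dimT_def[of X] bd by simp
qed

definition dTn :: "nat \<Rightarrow> 'a topology \<Rightarrow> ereal" where
  "dTn n X = Inf {dimT (subtopology X (topspace X - F)) | F.
     fsigma_in X F \<and> dimT (subtopology X F) \<le> ereal (of_nat n) - 1}"

end

theory Submission
  imports Defs
begin

text \<open>
  In a separable metric space of dimension at most \<open>k \<ge> 0\<close>, the union \<open>F\<close> of the boundaries of a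
  suitable countable base is an \<open>F\<^sub>\<sigma>\<close> set with zero-dimensional complement, and \<open>dim F \<le> k - 1\<close> by
  the countable sum theorem. Replacing \<open>F\<close> by an \<open>F\<^sub>\<sigma>\<close> subset \<open>E\<close> obtained recursively inside \<open>F\<close>
  with \<open>dim E \<le> n - 1\<close> and \<open>dim (F - E) \<le> k - 1 - n\<close>, the complement of \<open>E\<close> is the union of
  \<open>F - E\<close> and a zero-dimensional set, so it has dimension at most \<open>k - n\<close>. The reverse inequality
  is the Menger--Urysohn formula \<open>dim (A \<union> B) \<le> dim A + dim B + 1\<close>.
\<close>

section \<open>Countable bases in separable metric spaces\<close>

lemma (in Metric_space) separable_imp_second_countable:
  assumes "separable_space mtopology"
  shows "second_countable mtopology"
proof -
  obtain C where C: "countable C" "C \<subseteq> M" "mtopology closure_of C = M"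
    using assms unfolding separable_space_def by auto
  define \<B> where "\<B> = (\<lambda>(c, n). mball c (inverse (Suc n))) ` (C \<times> (UNIV::nat set))"
  show ?thesis
    unfolding second_countable_def
  proof (intro exI conjI ballI allI impI)
    show "countable \<B>"
      unfolding \<B>_def using C(1) by blast
    show "openin mtopology V" if "V \<in> \<B>" for V
      using that by (auto simp: \<B>_def)
    show "\<exists>V\<in>\<B>. x \<in> V \<and> V \<subseteq> U" if "openin mtopology U \<and> x \<in> U" for U x
    proof -
      have "\<exists>r>0. mball x r \<subseteq> U" and x: "x \<in> M"
        using that unfolding openin_mtopology by blast+
      then obtain r where r: "r > 0" "mball x r \<subseteq> U" by blast
      \<comment> \<open>A ball of radius below \<open>r / 2\<close> whose centre is that close to
        \<open>x\<close> contains \<open>x\<close> and, by the triangle inequality, stays inside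
        \<open>mball x r\<close>.\<close>
      obtain n where n: "inverse (Suc n) < r / 2"
        using reals_Archimedean[of "r / 2"] r(1) by auto
      have "x \<in> mtopology closure_of C" using C(3) x by simp
      moreover have "0 < inverse (real (Suc n))" by simp
      ultimately obtain c where c: "c \<in> C" "c \<in> mball x (inverse (Suc n))"
        unfolding metric_closure_of by blast
      have "mball c (inverse (Suc n)) \<subseteq> mball x r"
      proof
        fix y assume y: "y \<in> mball c (inverse (Suc n))"
        then have "d x y \<le> d x c + d c y" using x c by (intro triangle) auto
        also have "\<dots> < r" using y c n by auto
        finally show "y \<in> mball x r" using x y by auto
      qed
      moreover have "x \<in> mball c (inverse (Suc n))"
        using c by (auto simp: commute)
      moreover have "mball c (inverse (Suc n)) \<in> \<B>"
        unfolding \<B>_def using c(1) by force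
      ultimately show ?thesis using r by blast
    qed
  qed
qed

section \<open>Clopen separation and normality\<close>

text \<open>Every point has a clopen neighbourhood that misses \<open>A\<close> or \<open>B\<close>.
  The Lindelof property leaves countably many of them; making these disjoint preserves clopenness,
  since each piece drops only finitely many earlier sets. The pieces from sets that miss
  \<open>B\<close> make up \<open>C\<close>, and the remaining pieces form its complement, so both
  are open.\<close>

lemma zero_dimensional_clopen_separation:
  assumes X: "Lindelof_space X" "X dim_le 0"
    and A: "closedin X A" and B: "closedin X B" and AB: "disjnt A B"
  obtains C where "openin X C" "closedin X C" "A \<subseteq> C" "disjnt B C"
proof -
  define \<U> where "\<U> = {U. openin X U \<and> closedin X U \<and> (disjnt A U \<or> disjnt B U)}"
  have clopen: "\<exists>U. openin X U \<and> closedin X U \<and> x \<in> U \<and> U \<subseteq> V" if "openin X V" "x \<in> V" for x V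
    using X(2) that unfolding dimension_le_0_neighbourhood_base_of_clopen
    by (subst (asm) open_neighbourhood_base_of) blast+
  have "\<Union>\<U> = topspace X"
  proof
    show "topspace X \<subseteq> \<Union>\<U>"
    proof
      fix x assume x: "x \<in> topspace X"
      then have "x \<in> topspace X - A \<or> x \<in> topspace X - B"
        using AB by (auto simp: disjnt_iff)
      then obtain U where "openin X U" "closedin X U" "x \<in> U"
        "U \<subseteq> topspace X - A \<or> U \<subseteq> topspace X - B"
        using clopen[of "topspace X - A" x] clopen[of "topspace X - B" x] A B by blast
      then have "U \<in> \<U>" by (auto simp: \<U>_def disjnt_iff)
      with \<open>x \<in> U\<close> show "x \<in> \<Union>\<U>" by blast
    qed
  qed (auto simp: \<U>_def dest: openin_subset)
  moreover have "\<And>U. U \<in> \<U> \<Longrightarrow> openin X U" by (simp add: \<U>_def)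
  ultimately obtain \<V> where \<V>: "countable \<V>" "\<V> \<subseteq> \<U>" "\<Union>\<V> = topspace X"
    using Lindelof_spaceD[OF X(1)] by metis
  \<comment> \<open>Inserting \<open>{}\<close> makes the enumerated set nonempty, so that the range
    of \<open>from_nat_into\<close> is exactly that set.\<close>
  define V where "V = from_nat_into (insert {} \<V>)"
  have rV: "range V = insert {} \<V>"
    unfolding V_def using \<V>(1) by (intro range_from_nat_into) auto
  have "{} \<in> \<U>" by (simp add: \<U>_def)
  then have V\<U>: "V n \<in> \<U>" for n
    using rV \<V>(2) by (metis insert_subset rangeI subsetD)
  have D: "openin X (disjointed V n)" "closedin X (disjointed V n)" for n
  proof -
    have "openin X (\<Union>i\<in>{0..<n}. V i)" "closedin X (\<Union>i\<in>{0..<n}. V i)"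
      using V\<U> by (auto simp: \<U>_def intro!: openin_Union closedin_Union)
    then show "openin X (disjointed V n)" "closedin X (disjointed V n)"
      using V\<U>[of n] unfolding disjointed_def by (auto simp: \<U>_def intro: openin_diff closedin_diff)
  qed
  have UD: "(\<Union>n. disjointed V n) = topspace X"
    using rV \<V>(3) by (simp add: UN_disjointed_eq)
  define I where "I = {n. disjnt B (V n)}"
  define C where "C = (\<Union>n\<in>I. disjointed V n)"
  have "m = n" if "x \<in> disjointed V m" "x \<in> disjointed V n" for x m n
    using disjoint_family_disjointed[of V] that unfolding disjoint_family_on_def by blast
  then have "topspace X - C = (\<Union>n\<in>-I. disjointed V n)"
    unfolding C_def UD[symmetric] by blast
  then have "openin X (topspace X - C)" using D by auto
  moreover have oC: "openin X C" using D by (auto simp: C_def)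
  ultimately have "closedin X C" by (simp add: closedin_def openin_subset)
  have *: "disjnt A (V n)" if "n \<notin> I" for n
    using V\<U>[of n] that by (auto simp: I_def \<U>_def)
  have "A \<subseteq> C"
  proof (intro subsetI)
    fix x assume "x \<in> A"
    then obtain n where n: "x \<in> disjointed V n"
      using closedin_subset[OF A] UD by blast
    then have "x \<in> V n" using disjointed_subset[of V n] by blast
    then have "n \<in> I" using * \<open>x \<in> A\<close> by (auto simp: disjnt_iff)
    then show "x \<in> C" using n by (auto simp: C_def)
  qed
  moreover have "disjnt B C"
    using disjointed_subset[of V] unfolding C_def I_def disjnt_iff by blast
  ultimately show ?thesis using that oC \<open>closedin X C\<close> by blast
qed

lemma normal_space_disjoint_closuresE:
  assumes "normal_space X" "closedin X S" "closedin X T" "disjnt S T"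
  obtains U V where "openin X U" "openin X V" "S \<subseteq> U" "T \<subseteq> V"
    "disjnt (X closure_of U) (X closure_of V)"
  using assms unfolding normal_space_disjoint_closures by meson

section \<open>The countable sum theorem in dimension zero\<close>

lemma dim_le_0_countable_closed_Union:
  fixes F :: "nat \<Rightarrow> 'a set"
  assumes X: "metrizable_space X" "second_countable X"
    and F: "\<And>i. closedin X (F i)" "\<And>i. subtopology X (F i) dim_le 0"
    and cov: "(\<Union>i. F i) = topspace X"
  shows "X dim_le 0"
proof -
  have norm: "normal_space X" using X(1) by (rule metrizable_imp_normal_space)
  text \<open>Pairs of open sets with disjoint closures, growing to swallow one \<open>F i\<close> after the other,
    yield a partition into two clopen sets.\<close>
  define P where "P = (\<lambda>p. openin X (fst p) \<and> openin X (snd p) \<and>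
      disjnt (X closure_of fst p) (X closure_of snd p))"
  have step: "\<exists>q. P q \<and> fst p \<subseteq> fst q \<and> snd p \<subseteq> snd q \<and> F i \<subseteq> fst q \<union> snd q"
    if p: "P p" for p i
  proof -
    let ?A = "X closure_of fst p" and ?B = "X closure_of snd p"
    have "Lindelof_space (subtopology X (F i))"
      by (simp add: X second_countable_imp_Lindelof_space second_countable_subtopology)
    moreover have "closedin (subtopology X (F i)) (F i \<inter> ?A)" "closedin (subtopology X (F i)) (F i \<inter> ?B)"
      by (auto intro: closedin_subtopology_Int_closed)
    moreover have "disjnt (F i \<inter> ?A) (F i \<inter> ?B)" using p by (auto simp: P_def disjnt_iff)
    ultimately obtain C where C: "openin (subtopology X (F i)) C" "closedin (subtopology X (F i)) C"
        "F i \<inter> ?A \<subseteq> C" "disjnt (F i \<inter> ?B) C"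
      using F(2) by (metis zero_dimensional_clopen_separation)
    have CF: "C \<subseteq> F i" using C(2) closedin_imp_subset by blast
    \<comment> \<open>\<open>F i\<close> is closed in \<open>X\<close>, so both halves of its clopen
      partition are closed in \<open>X\<close>. Each half joins one of the closures, and normality
      enlarges the resulting disjoint closed sets.\<close>
    have "closedin X C" using C(2) F(1) closedin_trans_full by blast
    then have c1: "closedin X (?A \<union> C)" by (simp add: closedin_Un)
    have "closedin (subtopology X (F i)) (topspace (subtopology X (F i)) - C)"
      using C(1) by blast
    then have "closedin X (F i - C)"
      using F(1)[of i] by (metis closedin_subset closedin_trans_full topspace_subtopology_subset)
    then have c2: "closedin X (?B \<union> (F i - C))" by (simp add: closedin_Un)
    have dis: "disjnt (?A \<union> C) (?B \<union> (F i - C))"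
      using p C(3,4) CF by (auto simp: P_def disjnt_iff)
    obtain U V where UV: "openin X U" "openin X V" "?A \<union> C \<subseteq> U" "?B \<union> (F i - C) \<subseteq> V"
        "disjnt (X closure_of U) (X closure_of V)"
      using normal_space_disjoint_closuresE[OF norm c1 c2 dis] .
    have "fst p \<subseteq> ?A" "snd p \<subseteq> ?B"
      using p by (auto simp: P_def closure_of_subset openin_subset)
    then have "P (U, V)" "fst p \<subseteq> U" "snd p \<subseteq> V" "F i \<subseteq> U \<union> V"
      using UV by (auto simp: P_def)
    then show ?thesis by (metis fst_conv snd_conv)
  qed
  have "\<exists>U. closedin X U \<and> openin X U \<and> a \<in> U \<and> U \<subseteq> W" if W: "openin X W" "a \<in> W" for W a
  proof -
    have "a \<in> topspace X" using W openin_subset by blast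
    then have c1: "closedin X {a}"
      using metrizable_imp_t1_space[OF X(1)] by (simp add: t1_space_closedin_singleton)
    have c2: "closedin X (topspace X - W)" using W(1) by blast
    have dis: "disjnt {a} (topspace X - W)" using W by auto
    \<comment> \<open>Starting from \<open>{a}\<close> and the complement of \<open>W\<close> makes
      the limit \<open>U\<close> contain \<open>a\<close> and, once \<open>U\<close> and
      \<open>V\<close> partition the space, stay within \<open>W\<close>.\<close>
    obtain U0 V0 where 0: "openin X U0" "openin X V0" "{a} \<subseteq> U0" "topspace X - W \<subseteq> V0"
        "disjnt (X closure_of U0) (X closure_of V0)"
      using normal_space_disjoint_closuresE[OF norm c1 c2 dis] .
    define Q where "Q = (\<lambda>p. P p \<and> {a} \<subseteq> fst p \<and> topspace X - W \<subseteq> snd p)"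
    define R where "R = (\<lambda>n p q. fst p \<subseteq> fst q \<and> snd p \<subseteq> snd q \<and> F n \<subseteq> fst q \<union> snd q)"
    have "Q (U0, V0)" using 0 by (simp add: Q_def P_def)
    moreover have "\<exists>q. Q q \<and> R n p q" if p: "Q p" for p n
    proof -
      obtain q where "P q" "R n p q" using step[of p n] p unfolding Q_def R_def by blast
      moreover from this p have "Q q" by (auto simp: Q_def R_def)
      ultimately show ?thesis by blast
    qed
    ultimately obtain f where "\<And>n. Q (f n)" "\<And>n. R n (f n) (f (Suc n))"
      using dependent_nat_choice[of "\<lambda>_. Q" R] by metis
    then have f: "\<And>n. P (f n)" "\<And>n. {a} \<subseteq> fst (f n)" "\<And>n. topspace X - W \<subseteq> snd (f n)"
      "\<And>n. fst (f n) \<subseteq> fst (f (Suc n))" "\<And>n. snd (f n) \<subseteq> snd (f (Suc n))"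
      "\<And>n. F n \<subseteq> fst (f (Suc n)) \<union> snd (f (Suc n))"
      by (simp_all add: Q_def R_def)
    have disj: "disjnt (fst (f n)) (snd (f n))" for n
    proof -
      have "fst (f n) \<subseteq> X closure_of fst (f n)" "snd (f n) \<subseteq> X closure_of snd (f n)"
        using f(1)[of n] by (auto simp: P_def closure_of_subset openin_subset)
      then show ?thesis using f(1)[of n] by (auto simp: P_def disjnt_iff)
    qed
    define U where "U = (\<Union>n. fst (f n))"
    define V where "V = (\<Union>n. snd (f n))"
    have opn: "openin X U" "openin X V"
      using f(1) by (auto simp: U_def V_def P_def)
    \<comment> \<open>Both sequences increase, so sets from different stages can be compared at
      stage \<open>max m n\<close>.\<close>
    have "disjnt (fst (f m)) (snd (f n))" for m n
    proof -
      have "fst (f m) \<subseteq> fst (f (max m n))" "snd (f n) \<subseteq> snd (f (max m n))"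
        using lift_Suc_mono_le[of "\<lambda>n. fst (f n)" m "max m n"] f(4)
          lift_Suc_mono_le[of "\<lambda>n. snd (f n)" n "max m n"] f(5) by auto
      then show ?thesis
        using disj[of "max m n"] by (meson disjnt_subset1 disjnt_subset2)
    qed
    then have "disjnt U V" by (auto simp: U_def V_def disjnt_iff)
    moreover have "topspace X \<subseteq> U \<union> V"
      unfolding cov[symmetric]
    proof (intro UN_least)
      show "F n \<subseteq> U \<union> V" for n
        using f(6)[of n] unfolding U_def V_def by blast
    qed
    ultimately have UV: "topspace X - U = V"
      using openin_subset[OF opn(2)] unfolding disjnt_def by blast
    then have "closedin X U" using opn by (simp add: closedin_def openin_subset)
    moreover have "a \<in> U" using f(2) by (auto simp: U_def)
    moreover have "topspace X - W \<subseteq> V" using f(3)[of 0] unfolding V_def by blast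
    then have "U \<subseteq> W" using UV openin_subset[OF opn(1)] by blast
    ultimately show ?thesis using opn by blast
  qed
  then show ?thesis
    unfolding dimension_le_0_neighbourhood_base_of_clopen
    by (subst open_neighbourhood_base_of) blast+
qed

section \<open>Adding a zero-dimensional set\<close>

text \<open>Neighbourhoods of \<open>a\<close> and of the complement of \<open>W\<close> with
  disjoint closures leave disjoint closed traces on \<open>Z\<close>, which a clopen subset
  \<open>C\<close> of \<open>Z\<close> separates. Disjoint open sets, one around
  \<open>{a} \<union> C\<close> and one around the complement of \<open>W\<close> together with
  \<open>Z - C\<close>, then cover \<open>Z\<close>, so no point of \<open>Z\<close> lies on the
  frontier of the first.\<close>

lemma frontier_avoiding_zero_dimensional:
  assumes X: "metrizable_space X" "second_countable X"
    and Z: "Z \<subseteq> topspace X" "subtopology X Z dim_le 0" and W: "openin X W" "a \<in> W"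
  obtains U where "openin X U" "a \<in> U" "U \<subseteq> W" "disjnt Z (X frontier_of U)"
proof -
  have norm: "normal_space X" using X(1) by (rule metrizable_imp_normal_space)
  have aX: "a \<in> topspace X" using W openin_subset by blast
  then have c1: "closedin X {a}"
    using metrizable_imp_t1_space[OF X(1)] by (simp add: t1_space_closedin_singleton)
  have c2: "closedin X (topspace X - W)" using W(1) by blast
  have dis: "disjnt {a} (topspace X - W)" using W by auto
  obtain A B where AB: "openin X A" "openin X B" "{a} \<subseteq> A" "topspace X - W \<subseteq> B"
      "disjnt (X closure_of A) (X closure_of B)"
    using normal_space_disjoint_closuresE[OF norm c1 c2 dis] .
  have "Lindelof_space (subtopology X Z)"
    by (simp add: X second_countable_imp_Lindelof_space second_countable_subtopology)
  moreover have "closedin (subtopology X Z) (Z \<inter> X closure_of A)"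
      "closedin (subtopology X Z) (Z \<inter> X closure_of B)"
    by (auto intro: closedin_subtopology_Int_closed)
  moreover have "disjnt (Z \<inter> X closure_of A) (Z \<inter> X closure_of B)"
    using AB(5) by (auto simp: disjnt_iff)
  ultimately obtain C where C: "openin (subtopology X Z) C" "closedin (subtopology X Z) C"
      "Z \<inter> X closure_of A \<subseteq> C" "disjnt (Z \<inter> X closure_of B) C"
    using Z(2) by (metis zero_dimensional_clopen_separation)
  have CZ: "C \<subseteq> Z" using C(2) closedin_imp_subset by blast
  have sub: "A \<subseteq> X closure_of A" "B \<subseteq> X closure_of B"
    using AB by (auto simp: closure_of_subset openin_subset)
  text \<open>\<open>C\<close> and \<open>Z - C\<close> are closed in \<open>Z\<close> but not in \<open>X\<close>, so complete normality is needed to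
    separate them in \<open>X\<close>.\<close>
  have cl: "D = Z \<inter> X closure_of D" if "closedin (subtopology X Z) D" for D
    using that by (metis closedin_imp_subset closure_of_closedin closure_of_subtopology inf_absorb2)
  have ZC: "closedin (subtopology X Z) (Z - C)"
    using C(1) closedin_diff[OF closedin_topspace, of "subtopology X Z" C]
    by (simp only: topspace_subtopology_subset[OF Z(1)])
  have "C \<inter> X closure_of (Z - C) = {}" using cl[OF ZC] CZ by blast
  moreover have "(Z - C) \<inter> X closure_of C = {}" using cl[OF C(2)] by blast
  moreover have "a \<notin> X closure_of (Z - C)"
  proof -
    \<comment> \<open>An open set disjoint from a set is disjoint from its closure. \<open>A\<close>
      is used in this way against \<open>Z - C\<close>, and \<open>B\<close> below against
      \<open>C\<close>.\<close>
    have "A \<inter> (Z - C) = {}" using C(3) sub by blast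
    then have "A \<inter> X closure_of (Z - C) = {}"
      using AB(1) openin_Int_closure_of_eq_empty by blast
    then show ?thesis using AB(3) by blast
  qed
  moreover have "(topspace X - W) \<inter> X closure_of C = {}"
  proof -
    have "B \<inter> C = {}" using C(4) sub CZ by (auto simp: disjnt_iff)
    then have "B \<inter> X closure_of C = {}"
      using AB(2) openin_Int_closure_of_eq_empty by blast
    then show ?thesis using AB(4) by blast
  qed
  moreover have "{a} \<inter> X closure_of (topspace X - W) = {}"
      "(topspace X - W) \<inter> X closure_of {a} = {}"
    using c1 c2 W(2) by (simp_all add: closure_of_closedin)
  moreover have "C \<inter> X closure_of (topspace X - W) = {}"
    using AB(4) sub C(4) CZ unfolding closure_of_closedin[OF c2] disjnt_def by blast
  moreover have "(Z - C) \<inter> X closure_of {a} = {}"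
    using AB(3) sub C(3) c1 by (auto simp: closure_of_closedin)
  moreover have "{a} \<union> C \<subseteq> topspace X" "(topspace X - W) \<union> (Z - C) \<subseteq> topspace X"
    using aX CZ Z(1) by auto
  ultimately have "separatedin X ({a} \<union> C) ((topspace X - W) \<union> (Z - C))"
    unfolding separatedin_def closure_of_Un by auto
  then obtain U V where UV: "openin X U" "openin X V" "{a} \<union> C \<subseteq> U"
      "(topspace X - W) \<union> (Z - C) \<subseteq> V" "disjnt U V"
    using metrizable_space_separation[OF X(1)] by meson
  have "V \<inter> X closure_of U = {}"
    using UV(2,5) openin_Int_closure_of_eq_empty by (metis disjnt_def inf_commute)
  then have "disjnt Z (X frontier_of U)"
    using UV by (auto simp: frontier_of_openin disjnt_iff)
  moreover have "U \<subseteq> W"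
    using UV openin_subset[OF UV(1)] by (auto simp: disjnt_iff)
  ultimately show ?thesis using that UV by blast
qed

text \<open>A frontier that avoids \<open>Z\<close> lies in \<open>Y\<close> and inherits the bound
  \<open>k\<close>. This is the unit step by which dimensions add up in the inductions
  below.\<close>

lemma dim_le_add_zero_dimensional:
  assumes X: "metrizable_space X" "second_countable X"
    and Y: "subtopology X Y dim_le k" and Z: "subtopology X Z dim_le 0" and YZ: "Y \<union> Z = topspace X"
  shows "X dim_le k + 1"
proof (rule dimension_le.intros)
  show "- 1 \<le> k + 1" using dimension_le_bound[OF Y] by simp
  fix V a assume V: "openin X V" "a \<in> V"
  obtain U where U: "openin X U" "a \<in> U" "U \<subseteq> V" "disjnt Z (X frontier_of U)"
    using frontier_avoiding_zero_dimensional[OF X _ Z V] YZ by blast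
  have "X frontier_of U \<subseteq> Y"
    using U(4) YZ frontier_of_subset_topspace[of X U] by (auto simp: disjnt_iff)
  then have "subtopology X (X frontier_of U) dim_le k + 1 - 1"
    using dimension_le_subtopologies[OF Y] by simp
  then show "\<exists>U. a \<in> U \<and> U \<subseteq> V \<and> openin X U \<and> subtopology X (X frontier_of U) dim_le k + 1 - 1"
    using U by blast
qed

section \<open>Bases with frontiers of lower dimension\<close>

text \<open>Countability is inherited from an arbitrary countable base: between any two of its
  members that admit one, a single open set with small frontier is selected, and there are only
  countably many pairs.\<close>

lemma countable_base_small_frontiers:
  assumes X: "second_countable X" "X dim_le k"
  obtains \<U> where "countable \<U>"
    "\<And>U. U \<in> \<U> \<Longrightarrow> openin X U \<and> subtopology X (X frontier_of U) dim_le k - 1"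
    "\<And>V a. \<lbrakk>openin X V; a \<in> V\<rbrakk> \<Longrightarrow> \<exists>U\<in>\<U>. a \<in> U \<and> U \<subseteq> V"
proof -
  obtain \<B> where \<B>: "countable \<B>" "\<And>V. V \<in> \<B> \<Longrightarrow> openin X V"
    "\<And>U x. \<lbrakk>openin X U; x \<in> U\<rbrakk> \<Longrightarrow> \<exists>V \<in> \<B>. x \<in> V \<and> V \<subseteq> U"
    using X(1) by (auto simp: second_countable_def)
  define G where "G = (\<lambda>U. openin X U \<and> subtopology X (X frontier_of U) dim_le k - 1)"
  have G: "\<exists>U. G U \<and> a \<in> U \<and> U \<subseteq> V" if "openin X V" "a \<in> V" for V a
    using X(2) that unfolding G_def by (blast elim: dimension_le.cases)
  define \<P> where "\<P> = {p \<in> \<B> \<times> \<B>. \<exists>U. G U \<and> fst p \<subseteq> U \<and> U \<subseteq> snd p}"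
  define u where "u = (\<lambda>p. SOME U. G U \<and> fst p \<subseteq> U \<and> U \<subseteq> snd p)"
  have u: "G (u p)" "fst p \<subseteq> u p" "u p \<subseteq> snd p" if "p \<in> \<P>" for p
  proof -
    have "\<exists>U. G U \<and> fst p \<subseteq> U \<and> U \<subseteq> snd p" using that by (simp add: \<P>_def)
    from someI_ex[OF this] show "G (u p)" "fst p \<subseteq> u p" "u p \<subseteq> snd p"
      unfolding u_def by blast+
  qed
  have "countable \<P>"
    using \<B>(1) by (auto simp: \<P>_def intro: countable_subset[of _ "\<B> \<times> \<B>"])
  show ?thesis
  proof (rule that[of "u ` \<P>"])
    show "countable (u ` \<P>)" using \<open>countable \<P>\<close> by blast
    show "openin X U \<and> subtopology X (X frontier_of U) dim_le k - 1" if "U \<in> u ` \<P>" for U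
      using that u(1) by (auto simp: G_def)
    fix V a assume V: "openin X V" "a \<in> V"
    \<comment> \<open>The sandwich \<open>A \<subseteq> U \<subseteq> B\<close> puts the pair into
      \<open>\<P>\<close>. The selected \<open>u (A, B)\<close> may differ from \<open>U\<close>,
      but it still contains \<open>a\<close> and lies in \<open>V\<close>.\<close>
    obtain B where B: "B \<in> \<B>" "a \<in> B" "B \<subseteq> V" using \<B>(3)[OF V] by blast
    obtain U where U: "G U" "a \<in> U" "U \<subseteq> B" using G \<B>(2) B by meson
    obtain A where A: "A \<in> \<B>" "a \<in> A" "A \<subseteq> U" using \<B>(3) U by (meson G_def)
    have p: "(A, B) \<in> \<P>" using A B U by (auto simp: \<P>_def)
    then have "a \<in> u (A, B)" "u (A, B) \<subseteq> V" using u[OF p] A B by auto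
    then show "\<exists>U\<in>u ` \<P>. a \<in> U \<and> U \<subseteq> V" using p by blast
  qed
qed

text \<open>Once the frontiers of a countable base are removed, the base leaves clopen traces on the
  rest. The family is kept in place of its union because bounding the dimension of the union takes
  the countable sum theorem, whose proof uses this lemma.\<close>

lemma countable_closed_family_zero_dimensional_complement:
  assumes X: "second_countable X" "X dim_le k"
  obtains \<C> where "countable \<C>"
    "\<And>C. C \<in> \<C> \<Longrightarrow> closedin X C" "\<And>C. C \<in> \<C> \<Longrightarrow> subtopology X C dim_le k - 1"
    "subtopology X (topspace X - \<Union>\<C>) dim_le 0"
proof -
  obtain \<U> where \<U>: "countable \<U>"
    "\<And>U. U \<in> \<U> \<Longrightarrow> openin X U \<and> subtopology X (X frontier_of U) dim_le k - 1"
    "\<And>V a. \<lbrakk>openin X V; a \<in> V\<rbrakk> \<Longrightarrow> \<exists>U\<in>\<U>. a \<in> U \<and> U \<subseteq> V"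
    using countable_base_small_frontiers[OF X] by metis
  define S where "S = topspace X - \<Union>((frontier_of) X ` \<U>)"
  have "subtopology X S dim_le 0"
  proof (subst dimension_le_eq_subtopology, intro conjI allI impI)
    fix V a assume V: "openin X V \<and> a \<in> V \<and> a \<in> S"
    then obtain U where U: "U \<in> \<U>" "a \<in> U" "U \<subseteq> V" using \<U>(3) by blast
    \<comment> \<open>The relative frontier of \<open>S \<inter> U\<close> lies in this
      intersection; being empty, it has dimension at most \<open>0 - 1\<close>.\<close>
    have "S \<inter> X frontier_of U = {}" using U(1) by (auto simp: S_def)
    then have "subtopology X S frontier_of (S \<inter> U) = {}"
      using frontier_of_subtopology_subset[of S X U] frontier_of_subset_subtopology[of X S U]
        frontier_of_restrict[of "subtopology X S" U] frontier_of_restrict[of "subtopology X S" "S \<inter> U"]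
      by (auto simp: Int_assoc)
    then show "\<exists>U. a \<in> U \<and> U \<subseteq> V \<and> openin X U \<and>
        subtopology X (subtopology X S frontier_of (S \<inter> U)) dim_le 0 - 1"
      using U \<U>(2) by auto
  qed simp
  then show ?thesis
    using \<U>(1,2) by (intro that[of "(frontier_of) X ` \<U>"]) (auto simp: S_def closedin_frontier_of)
qed

section \<open>The countable sum theorem\<close>

text \<open>Induction on the bound. Each member of \<open>\<C>\<close> splits into countably many
  closed sets with a bound one lower and a zero-dimensional rest. The induction hypothesis applies
  to the union of all these closed sets; the zero-dimensional set outside it raises the bound by
  one.\<close>

theorem dim_le_countable_closed_Union:
  assumes "metrizable_space X" "second_countable X" "countable \<C>"
    and "\<And>C. C \<in> \<C> \<Longrightarrow> closedin X C" "\<And>C. C \<in> \<C> \<Longrightarrow> subtopology X C dim_le k"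
    and "\<Union>\<C> = topspace X" "-1 \<le> k"
  shows "X dim_le k"
proof -
  have main: "X dim_le int n" if "metrizable_space X" "second_countable X" "countable \<C>"
    "\<And>C. C \<in> \<C> \<Longrightarrow> closedin X C" "\<And>C. C \<in> \<C> \<Longrightarrow> subtopology X C dim_le int n"
    "\<Union>\<C> = topspace X" for n and X :: "'a topology" and \<C>
    using that
  proof (induction n arbitrary: X \<C>)
    case (0 X \<C>)
    define F where "F = from_nat_into (insert {} \<C>)"
    have rF: "range F = insert {} \<C>"
      unfolding F_def using 0(3) by (intro range_from_nat_into) auto
    have mem: "F i \<in> insert {} \<C>" for i using rF rangeI[of F i] by simp
    have "subtopology X {} dim_le 0"
      by (rule dimension_le_mono[of _ "-1"]) auto
    then have "subtopology X (F i) dim_le 0" for i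
      using mem[of i] 0(5) by auto
    moreover have "closedin X (F i)" for i
      using mem[of i] 0(4) by auto
    moreover have "(\<Union>i. F i) = topspace X" using rF 0(6) by auto
    ultimately show ?case using dim_le_0_countable_closed_Union 0(1,2) by (metis of_nat_0)
  next
    case (Suc n X \<C>)
    have "\<exists>\<D>. countable \<D> \<and> (\<forall>D\<in>\<D>. closedin (subtopology X C) D \<and>
        subtopology (subtopology X C) D dim_le int n) \<and>
        subtopology (subtopology X C) (topspace (subtopology X C) - \<Union>\<D>) dim_le 0" if "C \<in> \<C>" for C
      using countable_closed_family_zero_dimensional_complement
        [OF second_countable_subtopology[OF Suc.prems(2)] Suc.prems(5)[OF that]]
      by (metis add_diff_cancel_right' of_nat_Suc add.commute)
    then obtain \<D> where \<D>: "\<And>C. C \<in> \<C> \<Longrightarrow> countable (\<D> C)"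
      "\<And>C D. \<lbrakk>C \<in> \<C>; D \<in> \<D> C\<rbrakk> \<Longrightarrow> closedin (subtopology X C) D"
      "\<And>C D. \<lbrakk>C \<in> \<C>; D \<in> \<D> C\<rbrakk> \<Longrightarrow> subtopology (subtopology X C) D dim_le int n"
      "\<And>C. C \<in> \<C> \<Longrightarrow>
        subtopology (subtopology X C) (topspace (subtopology X C) - \<Union>(\<D> C)) dim_le 0"
      by metis
    define \<E> where "\<E> = (\<Union>C\<in>\<C>. \<D> C)"
    have \<E>: "closedin X D" "subtopology X D dim_le int n" if D: "D \<in> \<E>" for D
    proof -
      obtain C where C: "C \<in> \<C>" "D \<in> \<D> C" using D unfolding \<E>_def by blast
      then show "closedin X D" using \<D>(2) Suc.prems(4) closedin_trans_full by blast
      have "D \<subseteq> C" using \<D>(2)[OF C] closedin_imp_subset by blast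
      then show "subtopology X D dim_le int n"
        using \<D>(3)[OF C] by (simp add: subtopology_subtopology Int_absorb1)
    qed
    text \<open>Off \<open>\<Union>\<E>\<close> every member of \<open>\<C>\<close> is zero-dimensional, so the case of dimension 0 applies.\<close>
    define Z where "Z = topspace X - \<Union>\<E>"
    have EX: "\<Union>\<E> \<subseteq> topspace X" using \<E>(1) closedin_subset by blast
    have "subtopology X (\<Union>\<E>) dim_le int n"
    proof (rule Suc.IH)
      show "countable \<E>" using Suc.prems(3) \<D>(1) by (auto simp: \<E>_def)
      show "closedin (subtopology X (\<Union>\<E>)) D" if "D \<in> \<E>" for D
        using \<E>(1)[OF that] that by (intro closedin_subset_topspace) auto
      show "subtopology (subtopology X (\<Union>\<E>)) D dim_le int n" if "D \<in> \<E>" for D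
        using \<E>(2)[OF that] that by (simp add: subtopology_subtopology Int_absorb1 Union_upper)
    qed (use Suc.prems EX in \<open>auto simp: metrizable_space_subtopology second_countable_subtopology\<close>)
    moreover have "subtopology X Z dim_le 0"
    proof -
      define F where "F = from_nat_into (insert {} ((\<lambda>C. C \<inter> Z) ` \<C>))"
      have rF: "range F = insert {} ((\<lambda>C. C \<inter> Z) ` \<C>)"
        unfolding F_def using Suc.prems(3) by (intro range_from_nat_into) auto
      have mem: "F i \<in> insert {} ((\<lambda>C. C \<inter> Z) ` \<C>)" for i using rF rangeI[of F i] by simp
      show ?thesis
      proof (rule dim_le_0_countable_closed_Union)
        show "closedin (subtopology X Z) (F i)" for i
          using mem[of i] Suc.prems(4) by (auto simp: closedin_subtopology)
        show "subtopology (subtopology X Z) (F i) dim_le 0" for i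
        proof (cases "F i = {}")
          case True
          then show ?thesis by (auto intro: dimension_le_mono[of _ "-1"])
        next
          case False
          then obtain C where C: "C \<in> \<C>" "F i = C \<inter> Z" using mem[of i] by auto
          have "C \<inter> Z \<subseteq> topspace (subtopology X C) - \<Union>(\<D> C)"
            using C by (auto simp: Z_def \<E>_def)
          then have "subtopology (subtopology X C) (C \<inter> Z) dim_le 0"
            by (rule dimension_le_subtopologies[OF \<D>(4)[OF C(1)]])
          then show ?thesis
            by (simp add: C(2) subtopology_subtopology Int_ac)
        qed
        show "(\<Union>i. F i) = topspace (subtopology X Z)"
          using rF Suc.prems(6) by (auto simp: Z_def)
      qed (use Suc.prems in \<open>auto simp: metrizable_space_subtopology second_countable_subtopology\<close>)
    qed
    moreover have "\<Union>\<E> \<union> Z = topspace X" using EX by (auto simp: Z_def)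
    ultimately show ?case
      using dim_le_add_zero_dimensional[OF Suc.prems(1,2), of "\<Union>\<E>" "int n" Z]
      by (simp add: add.commute)
  qed
  show ?thesis
  \<comment> \<open>The induction starts at dimension 0. In dimension -1 all members are empty;
    \<open>-1 \<le> k\<close> excludes lower values, for which the empty family would refute the
    claim.\<close>
  proof (cases "k = -1")
    case True
    then have "C = {}" if "C \<in> \<C>" for C
      using assms(5)[OF that] closedin_subset[OF assms(4)[OF that]]
      by (auto simp: subtopology_trivial_iff disjnt_def)
    then have "\<Union>\<C> = {}" by blast
    then show ?thesis using True assms(6) by simp
  next
    case False
    then have "int (nat k) = k" using assms(7) by simp
    then show ?thesis using main[of X \<C> "nat k"] assms by simp
  qed
qed

section \<open>Decompositions and the Menger--Urysohn formula\<close>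

text \<open>The countable sum theorem gives the union of the closed family the bound of its members;
  \<open>0 \<le> k\<close> ensures that \<open>k - 1\<close> is at least -1, as that theorem
  requires.\<close>

lemma fsigma_zero_dimensional_complement:
  assumes X: "metrizable_space X" "second_countable X" "X dim_le k" and k: "0 \<le> k"
  obtains F where "fsigma_in X F" "subtopology X F dim_le k - 1"
    "subtopology X (topspace X - F) dim_le 0"
proof -
  obtain \<C> where \<C>: "countable \<C>"
    "\<And>C. C \<in> \<C> \<Longrightarrow> closedin X C" "\<And>C. C \<in> \<C> \<Longrightarrow> subtopology X C dim_le k - 1"
    "subtopology X (topspace X - \<Union>\<C>) dim_le 0"
    using countable_closed_family_zero_dimensional_complement[OF X(2,3)] by metis
  have sub: "\<Union>\<C> \<subseteq> topspace X" using \<C>(2) closedin_subset by blast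
  have "subtopology X (\<Union>\<C>) dim_le k - 1"
  proof (rule dim_le_countable_closed_Union)
    show "closedin (subtopology X (\<Union>\<C>)) C" if "C \<in> \<C>" for C
      using \<C>(2)[OF that] that by (intro closedin_subset_topspace) auto
    show "subtopology (subtopology X (\<Union>\<C>)) C dim_le k - 1" if "C \<in> \<C>" for C
      using \<C>(3)[OF that] that by (simp add: subtopology_subtopology Int_absorb1 Union_upper)
  qed (use X \<C>(1) sub k in \<open>auto simp: metrizable_space_subtopology second_countable_subtopology\<close>)
  moreover have "fsigma_in X (\<Union>\<C>)"
    using \<C>(1,2) by (intro fsigma_in_Union closed_imp_fsigma_in)
  ultimately show ?thesis using that \<C>(4) by blast
qed

text \<open>A zero-dimensional part \<open>A - F\<close> is split off from \<open>A\<close>, the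
  induction hypothesis applies to \<open>F \<union> B\<close>, and restoring the part costs one
  dimension.\<close>

theorem dim_le_Un:
  assumes "metrizable_space X" "second_countable X"
    and "subtopology X A dim_le k" "subtopology X B dim_le l" "A \<union> B = topspace X"
  shows "X dim_le k + l + 1"
proof -
  \<comment> \<open>\<open>n\<close> stands for \<open>k + 1\<close>, so the induction begins with
    \<open>A\<close> empty, where the summand 1 cancels the dimension -1.\<close>
  have "X dim_le (int n - 1) + l + 1" if "metrizable_space X" "second_countable X"
    "subtopology X A dim_le int n - 1" "subtopology X B dim_le l" "A \<union> B = topspace X"
    for n and X :: "'a topology" and A B
    using that
  proof (induction n arbitrary: X A B)
    case (0 X A B)
    then have "A \<inter> topspace X = {}"
      by (auto simp: subtopology_trivial_iff disjnt_def)
    then have "B = topspace X" using 0(5) by blast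
    then show ?case using 0(4) by simp
  next
    case (Suc n X A B)
    have AX: "A \<subseteq> topspace X" "B \<subseteq> topspace X" using Suc.prems(5) by auto
    obtain F where F: "fsigma_in (subtopology X A) F"
      "subtopology (subtopology X A) F dim_le int (Suc n) - 1 - 1"
      "subtopology (subtopology X A) (topspace (subtopology X A) - F) dim_le 0"
      using Suc.prems
      by (metis fsigma_zero_dimensional_complement[of "subtopology X A" "int (Suc n) - 1"]
          metrizable_space_subtopology second_countable_subtopology
          diff_ge_0_iff_ge of_nat_Suc le_add_same_cancel1 of_nat_0_le_iff)
    have FA: "F \<subseteq> A" using F(1) fsigma_in_subset AX by fastforce
    have "subtopology X (F \<union> B) dim_le (int n - 1) + l + 1"
    proof (rule Suc.IH[where A = F and B = B])
      show "subtopology (subtopology X (F \<union> B)) F dim_le int n - 1"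
        using F(2) FA by (simp add: subtopology_subtopology Int_absorb1)
      show "subtopology (subtopology X (F \<union> B)) B dim_le l"
        using Suc.prems(4) by (simp add: subtopology_subtopology Int_absorb1)
    qed (use Suc.prems FA in \<open>auto simp: metrizable_space_subtopology second_countable_subtopology\<close>)
    moreover have "subtopology X (A - F) dim_le 0"
      using F(3) AX by (simp add: subtopology_subtopology Int_absorb1 Int_absorb2 Diff_subset)
    moreover have "(F \<union> B) \<union> (A - F) = topspace X"
      using FA Suc.prems(5) by auto
    ultimately have "X dim_le ((int n - 1) + l + 1) + 1"
      by (rule dim_le_add_zero_dimensional[OF Suc.prems(1,2)])
    then show ?case by (simp add: algebra_simps)
  qed
  from this[of X A "nat (k + 1)" B] show ?thesis
    using assms dimension_le_bound[OF assms(3)] by simp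
qed

text \<open>The range of \<open>n\<close> includes both trivial ends: an empty \<open>F\<close> at
  \<open>n = 0\<close> and an empty complement at \<open>n = k + 1\<close>. The recursion lowers
  \<open>k\<close> with \<open>n\<close> fixed until it reaches the second end.\<close>

theorem fsigma_decomposition:
  assumes "metrizable_space X" "second_countable X" "X dim_le k" "0 \<le> n" "n \<le> k + 1"
  obtains F where "fsigma_in X F" "subtopology X F dim_le n - 1"
    "subtopology X (topspace X - F) dim_le k - n"
proof -
  have "\<exists>F. fsigma_in X F \<and> subtopology X F dim_le n - 1 \<and>
      subtopology X (topspace X - F) dim_le (int m - 1) - n"
    if "metrizable_space X" "second_countable X" "X dim_le int m - 1" "n \<le> int m"
    for m and X :: "'a topology"
    using that
  proof (induction m arbitrary: X)
    case (0 X)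
    then have "n = 0" using assms(4) by simp
    with 0 show ?case by (intro exI[of _ "{}"]) simp
  next
    case (Suc m X)
    show ?case
    proof (cases "n = int (Suc m)")
      case True
      then show ?thesis using Suc.prems(3) by (intro exI[of _ "topspace X"]) simp
    next
      case False
      obtain F where F: "fsigma_in X F" "subtopology X F dim_le int (Suc m) - 1 - 1"
        "subtopology X (topspace X - F) dim_le 0"
        using fsigma_zero_dimensional_complement[OF Suc.prems(1-3)] by auto
      have FX: "F \<subseteq> topspace X" using F(1) fsigma_in_subset by blast
      \<comment> \<open>The bound on \<open>F\<close> is \<open>int m - 1\<close>, and
        \<open>n \<le> int m\<close> since \<open>n = int (Suc m)\<close> is excluded, so the
        induction hypothesis covers the subspace \<open>F\<close>.\<close>
      have "\<exists>E. fsigma_in (subtopology X F) E \<and> subtopology (subtopology X F) E dim_le n - 1 \<and>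
          subtopology (subtopology X F) (topspace (subtopology X F) - E) dim_le (int m - 1) - n"
        using Suc.prems F(2) False
        by (intro Suc.IH metrizable_space_subtopology second_countable_subtopology) auto
      then obtain E where E: "fsigma_in (subtopology X F) E"
        "subtopology (subtopology X F) E dim_le n - 1"
        "subtopology (subtopology X F) (topspace (subtopology X F) - E) dim_le (int m - 1) - n"
        by blast
      have E': "fsigma_in X E" "E \<subseteq> F"
        using E(1) F(1) fsigma_in_fsigma_subtopology by blast+
      have "subtopology X (topspace X - E) dim_le ((int m - 1) - n) + 1"
      proof (rule dim_le_add_zero_dimensional[where Y = "F - E" and Z = "topspace X - F"])
        have "(topspace X - E) \<inter> (F - E) = F - E" using FX by blast
        then show "subtopology (subtopology X (topspace X - E)) (F - E) dim_le (int m - 1) - n"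
          using E(3) FX by (simp add: subtopology_subtopology Int_absorb1 Int_absorb2 Diff_subset)
        have "(topspace X - E) \<inter> (topspace X - F) = topspace X - F" using E'(2) by blast
        then show "subtopology (subtopology X (topspace X - E)) (topspace X - F) dim_le 0"
          using F(3) by (simp add: subtopology_subtopology)
      qed (use Suc.prems FX E' in
          \<open>auto simp: metrizable_space_subtopology second_countable_subtopology\<close>)
      moreover have "subtopology X E dim_le n - 1"
        using E(2) E'(2) by (simp add: subtopology_subtopology Int_absorb1)
      ultimately show ?thesis using E'(1) by (intro exI[of _ E]) (simp add: algebra_simps)
    qed
  qed
  from this[of X "nat (k + 1)"] show ?thesis
    using that assms dimension_le_bound[OF assms(3)] by auto
qed

section \<open>Evaluation of \<open>dTn\<close> by two inequalities\<close>

theorem theorem3p8: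
  fixes M :: "'a set" and d :: "'a \<Rightarrow> 'a \<Rightarrow> real" and n :: nat
  assumes "Metric_space M d"
    and "separable_space (Metric_space.mtopology M d)"
    and "1 \<le> n"
    and "ereal (of_nat n) \<le> dimT (Metric_space.mtopology M d)"
  shows "dTn n (Metric_space.mtopology M d) = dimT (Metric_space.mtopology M d) - ereal (of_nat n)"
proof -
  define X where "X = Metric_space.mtopology M d"
  have X: "metrizable_space X" "second_countable X"
    using assms(1,2) Metric_space.separable_imp_second_countable[OF assms(1)]
    by (auto simp: X_def Metric_space.metrizable_space_mtopology)
  have small: "dimT Y \<le> ereal (of_nat n) - 1 \<longleftrightarrow> Y dim_le int n - 1" for Y :: "'a topology"
    using dimT_le_iff[of Y "int n - 1"] by (simp add: one_ereal_def)
  have "dimT X - ereal (of_nat n) \<le> dTn n X"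
    unfolding dTn_def small
  proof (rule Inf_greatest, safe)
    fix F assume F: "fsigma_in X F" "subtopology X F dim_le int n - 1"
    show "dimT X - ereal (of_nat n) \<le> dimT (subtopology X (topspace X - F))"
      unfolding dimT_def[of "subtopology X (topspace X - F)"]
    \<comment> \<open>Only integer bounds \<open>m\<close> on the complement need checking: if there
      are none, its dimension is infinite and the inequality holds.\<close>
    proof (rule Inf_greatest, safe)
      fix m assume "subtopology X (topspace X - F) dim_le m"
      moreover have "F \<union> (topspace X - F) = topspace X"
        using fsigma_in_subset[OF F(1)] by blast
      ultimately have "X dim_le (int n - 1) + m + 1"
        using X F(2) by (intro dim_le_Un)
      then have "dimT X \<le> ereal (of_int (int n + m))"
        by (subst dimT_le_iff) (simp add: algebra_simps)
      then show "dimT X - ereal (of_nat n) \<le> ereal (of_int m)"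
        by (cases "dimT X") auto
    qed
  qed
  \<comment> \<open>With \<open>n\<close> added on the left, \<open>dimT X\<close> stands alone on
    the right and unfolds to an infimum over integer bounds \<open>k\<close>, which is infinite if
    there are none.\<close>
  moreover have "dTn n X + ereal (of_nat n) \<le> dimT X"
    unfolding dimT_def[of X]
  proof (rule Inf_greatest, safe)
    fix k assume k: "X dim_le k"
    \<comment> \<open>The dimension hypothesis makes every bound \<open>k\<close> at least
      \<open>n\<close>, which places \<open>n\<close> in the range of the decomposition.\<close>
    then have "ereal (of_nat n) \<le> ereal (of_int k)"
      using assms(4) dimT_le_iff[of X k] unfolding X_def by (meson order_trans)
    then have "int n \<le> k + 1" by simp
    then obtain F where F: "fsigma_in X F" "subtopology X F dim_le int n - 1"
      "subtopology X (topspace X - F) dim_le k - int n"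
      using fsigma_decomposition[OF X k] by (metis of_nat_0_le_iff)
    have "dTn n X \<le> dimT (subtopology X (topspace X - F))"
      unfolding dTn_def small using F by (intro Inf_lower) auto
    also have "\<dots> \<le> ereal (of_int (k - int n))" using F(3) by (subst dimT_le_iff)
    finally show "dTn n X + ereal (of_nat n) \<le> ereal (of_int k)"
      by (cases "dTn n X") auto
  qed
  then have "dTn n X \<le> dimT X - ereal (of_nat n)"
    by (cases "dTn n X"; cases "dimT X") auto
  ultimately show ?thesis unfolding X_def by (rule antisym[rotated])
qed

end
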